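(* Let $f:\mathcal{A}'\to\mathcal{A}$ be a $^*$-homomorphism of $C^*$-algebras. Then the diagram of functors with sides $\mathbf{AnRep}_f$, $\mathbf{OCP}_f$, $\mathbf{rest}_{\mathcal{A}}$, $\mathbf{rest}_{\mathcal{A}'}$ commutes on the nose, i.e. $$\mathbf{rest}_{\mathcal{A}'}\circ\mathbf{AnRep}_f=\mathbf{OCP}_f\circ\mathbf{rest}_{\mathcal{A}}$$ as functors $\mathbf{AnRep}(\mathcal{A})\to\mathbf{OCP}(\mathcal{A}')$. A similar statement holds for the subcategories obtained from $\mathbf{PAnRep}$ and $\mathbf{OpSt}$, i.e. $\mathbf{rest}_{\mathcal{A}'}\circ\mathbf{PAnRep}_f=\mathbf{OpSt}_f\circ\mathbf{rest}_{\mathcal{A}}$ as functors $\mathbf{PAnRep}(\mathcal{A})\to\mathbf{OpSt}(\mathcal{A}')$.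
   Context: All $C^*$-algebras and $^*$-homomorphisms (in particular all representations) are unital. CP means completely positive; $\mathcal{B}(\mathcal{K})$ denotes the bounded operators on a Hilbert space $\mathcal{K}$. An OCP map on $\mathcal{A}$ is a pair $(\mathcal{K},\varphi)$ with $\mathcal{K}$ a Hilbert space and $\varphi:\mathcal{A}\to\mathcal{B}(\mathcal{K})$ a CP linear map; it is an operator state if $\varphi$ is unital. A morphism $T:(\mathcal{K},\varphi)\to(\mathcal{L},\psi)$ of OCP maps is a bounded linear map $T:\mathcal{K}\to\mathcal{L}$ with $T\varphi(a)=\psi(a)T$ for all $a\in\mathcal{A}$; a morphism of operator states is such a $T$ between operator states that is an isometry. These form categories $\mathbf{OCP}(\mathcal{A})$ and $\mathbf{OpSt}(\mathcal{A})\subseteq\mathbf{OCP}(\mathcal{A})$. The functor $\mathbf{OCP}_f:\mathbf{OCP}(\mathcal{A})\to\mathbf{OCP}(\mathcal{A}')$ sends $(\mathcal{K},\varphi)$ to $(\mathcal{K},\varphi\circ f)$ and $T$ to $T$; its restriction to operator states is $\mathbf{OpSt}_f$. An anchored representation of $\mathcal{A}$ is a quadruple $(\mathcal{K},\mathcal{H},\pi,V)$ with $\mathcal{K},\mathcal{H}$ Hilbert spaces, $\pi:\mathcal{A}\to\mathcal{B}(\mathcal{H})$ a $^*$-homomorphism, and $V:\mathcal{K}\to\mathcal{H}$ bounded linear; it is preserving if $V$ is an isometry. A morphism $(T,L):(\mathcal{K},\mathcal{H},\pi,V)\to(\mathcal{L},\mathcal{I},\rho,W)$ consists of bounded linear maps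 $T:\mathcal{K}\to\mathcal{L}$, $L:\mathcal{H}\to\mathcal{I}$ with $L\pi(a)=\rho(a)L$ for all $a\in\mathcal{A}$, $LV=WT$, and $TV^*=W^*L$; a morphism of preserving anchored representations is such a pair with $V,W,T,L$ isometries. These form categories $\mathbf{AnRep}(\mathcal{A})$ and $\mathbf{PAnRep}(\mathcal{A})\subseteq\mathbf{AnRep}(\mathcal{A})$ with $(S,M)\circ(T,L)=(ST,ML)$. The functor $\mathbf{AnRep}_f:\mathbf{AnRep}(\mathcal{A})\to\mathbf{AnRep}(\mathcal{A}')$ sends $(\mathcal{K},\mathcal{H},\pi,V)$ to $(\mathcal{K},\mathcal{H},\pi\circ f,V)$ and $(T,L)$ to $(T,L)$; its restriction is $\mathbf{PAnRep}_f$. The functor $\mathbf{rest}_{\mathcal{A}}:\mathbf{AnRep}(\mathcal{A})\to\mathbf{OCP}(\mathcal{A})$ sends $(\mathcal{K},\mathcal{H},\pi,V)$ to $(\mathcal{K},V^*\pi(\cdot)V)$ and $(T,L)$ to $T$; it restricts to a functor $\mathbf{PAnRep}(\mathcal{A})\to\mathbf{OpSt}(\mathcal{A})$. *)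

theory Defs
  imports Complex_Main "HOL-Library.FuncSet" "HOL-Library.Nonpos_Ints" "HOL-Algebra.Module"
begin

section \<open>C*-algebras\<close>

text \<open>
  Unital C*-algebras as a type class. The class \<^class>\<open>monoid_mult\<close> is used for the unit
  (and not \<^class>\<open>real_normed_algebra_1\<close>) so that the zero algebra is not excluded.
  The real vector space structure of the library is the restriction of the complex one.
\<close>

class cstar_algebra = real_normed_algebra + monoid_mult + banach +
  fixes cscale :: "complex \<Rightarrow> 'a \<Rightarrow> 'a" (infixr \<open>*\<^sub>c\<close> 75)
    and star :: "'a \<Rightarrow> 'a"
  assumes cscale_of_real: "complex_of_real r *\<^sub>c x = r *\<^sub>R x"
    and cscale_add_right: "c *\<^sub>c (x + y) = c *\<^sub>c x + c *\<^sub>c y"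
    and cscale_add_left: "(c + d) *\<^sub>c x = c *\<^sub>c x + d *\<^sub>c x"
    and cscale_cscale: "c *\<^sub>c d *\<^sub>c x = (c * d) *\<^sub>c x"
    and mult_cscale_left: "(c *\<^sub>c x) * y = c *\<^sub>c (x * y)"
    and mult_cscale_right: "x * (c *\<^sub>c y) = c *\<^sub>c (x * y)"
    and norm_cscale: "norm (c *\<^sub>c x) = cmod c * norm x"
    and star_add: "star (x + y) = star x + star y"
    and star_cscale: "star (c *\<^sub>c x) = cnj c *\<^sub>c star x"
    and star_mult: "star (x * y) = star y * star x"
    and star_star: "star (star x) = x"
    and cstar_identity: "norm (star x * x) = (norm x)\<^sup>2"

definition star_hom :: "('b::cstar_algebra \<Rightarrow> 'a::cstar_algebra) \<Rightarrow> bool" where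
  "star_hom f \<longleftrightarrow>
     (\<forall>x y. f (x + y) = f x + f y) \<and> (\<forall>c x. f (c *\<^sub>c x) = c *\<^sub>c f x) \<and>
     (\<forall>x y. f (x * y) = f x * f y) \<and> f 1 = 1 \<and> (\<forall>x. f (star x) = star (f x))"


section \<open>Hilbert spaces and bounded operators\<close>

text \<open>
  The objects of the categories below range over all Hilbert spaces whose underlying set is a
  subset of a type \<open>'h\<close>; that type is arbitrary. As with every HOL-Algebra module, the
  ring fields \<open>mult\<close> and \<open>one\<close> of the record are unused.
  Inner products are conjugate linear in the first argument.
\<close>

definition complex_ring :: "complex ring" where
  "complex_ring = \<lparr>carrier = UNIV, mult = (*), one = 1, zero = 0, add = (+)\<rparr>"

record 'h hilbert = "(complex, 'h) module" +
  cinner :: "'h \<Rightarrow> 'h \<Rightarrow> complex"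

definition hnorm :: "'h hilbert \<Rightarrow> 'h \<Rightarrow> real" where
  "hnorm H x = sqrt (Re (cinner H x x))"

locale hilbert_space = module complex_ring H for H :: "'h hilbert" (structure) +
  assumes cinner_add_right:
      "\<lbrakk>x \<in> carrier H; y \<in> carrier H; z \<in> carrier H\<rbrakk> \<Longrightarrow>
       cinner H x (y \<oplus> z) = cinner H x y + cinner H x z"
    and cinner_smult_right:
      "\<lbrakk>x \<in> carrier H; y \<in> carrier H\<rbrakk> \<Longrightarrow> cinner H x (c \<odot> y) = c * cinner H x y"
    and cinner_commute:
      "\<lbrakk>x \<in> carrier H; y \<in> carrier H\<rbrakk> \<Longrightarrow> cinner H x y = cnj (cinner H y x)"
    and cinner_nonneg: "x \<in> carrier H \<Longrightarrow> cinner H x x \<in> \<real>\<^sub>\<ge>\<^sub>0"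
    and cinner_eq_zero: "\<lbrakk>x \<in> carrier H; cinner H x x = 0\<rbrakk> \<Longrightarrow> x = \<zero>"
    and complete:
      "\<lbrakk>\<And>n. X n \<in> carrier H;
        \<And>e. e > 0 \<Longrightarrow> \<exists>N. \<forall>m\<ge>N. \<forall>n\<ge>N. hnorm H (X m \<ominus> X n) < e\<rbrakk> \<Longrightarrow>
       \<exists>l\<in>carrier H. (\<lambda>n. hnorm H (X n \<ominus> l)) \<longlonglongrightarrow> (0::real)"

text \<open>
  Operators are extensional functions (\<^term>\<open>undefined\<close> outside the carrier of their domain), so
  that equality of operators is equality in HOL; their composition is \<^const>\<open>compose\<close>.
\<close>

definition bounded_ops :: "'h hilbert \<Rightarrow> 'i hilbert \<Rightarrow> ('h \<Rightarrow> 'i) set" where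
  "bounded_ops H I = {T \<in> carrier H \<rightarrow>\<^sub>E carrier I.
     (\<forall>x\<in>carrier H. \<forall>y\<in>carrier H. T (x \<oplus>\<^bsub>H\<^esub> y) = T x \<oplus>\<^bsub>I\<^esub> T y) \<and>
     (\<forall>c. \<forall>x\<in>carrier H. T (c \<odot>\<^bsub>H\<^esub> x) = c \<odot>\<^bsub>I\<^esub> T x) \<and>
     (\<exists>B. \<forall>x\<in>carrier H. hnorm I (T x) \<le> B * hnorm H x)}"

definition isometries :: "'h hilbert \<Rightarrow> 'i hilbert \<Rightarrow> ('h \<Rightarrow> 'i) set" where
  "isometries H I = {T \<in> bounded_ops H I. \<forall>x\<in>carrier H. hnorm I (T x) = hnorm H x}"

definition id_op :: "'h hilbert \<Rightarrow> 'h \<Rightarrow> 'h" where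
  "id_op H = (\<lambda>x\<in>carrier H. x)"

definition adj :: "'h hilbert \<Rightarrow> 'i hilbert \<Rightarrow> ('h \<Rightarrow> 'i) \<Rightarrow> 'i \<Rightarrow> 'h" where
  "adj H I T = (\<lambda>y\<in>carrier I.
     THE x. x \<in> carrier H \<and> (\<forall>z\<in>carrier H. cinner H z x = cinner I (T z) y))"

definition linear_into_ops :: "'h hilbert \<Rightarrow> ('a::cstar_algebra \<Rightarrow> 'h \<Rightarrow> 'h) \<Rightarrow> bool" where
  "linear_into_ops H \<phi> \<longleftrightarrow>
     (\<forall>a. \<phi> a \<in> bounded_ops H H) \<and>
     (\<forall>a b. \<forall>x\<in>carrier H. \<phi> (a + b) x = \<phi> a x \<oplus>\<^bsub>H\<^esub> \<phi> b x) \<and>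
     (\<forall>c a. \<forall>x\<in>carrier H. \<phi> (c *\<^sub>c a) x = c \<odot>\<^bsub>H\<^esub> \<phi> a x)"

definition representation :: "'h hilbert \<Rightarrow> ('a::cstar_algebra \<Rightarrow> 'h \<Rightarrow> 'h) \<Rightarrow> bool" where
  "representation H \<pi> \<longleftrightarrow> linear_into_ops H \<pi> \<and>
     (\<forall>a b. \<pi> (a * b) = compose (carrier H) (\<pi> a) (\<pi> b)) \<and>
     \<pi> 1 = id_op H \<and> (\<forall>a. \<pi> (star a) = adj H H (\<pi> a))"


section \<open>Completely positive maps\<close>

text \<open>
  An \<open>n \<times> n\<close> matrix is given by its entries at indices below \<open>n\<close>. It is positive in
  the C*-algebra of \<open>n \<times> n\<close> matrices over \<open>'a\<close> iff it is of the form \<open>b\<^sup>* b\<close>; a matrix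
  of operators is positive iff it is positive as an operator on the \<open>n\<close>-fold direct sum.
\<close>

definition positive_matrix :: "nat \<Rightarrow> (nat \<Rightarrow> nat \<Rightarrow> 'a::cstar_algebra) \<Rightarrow> bool" where
  "positive_matrix n a \<longleftrightarrow>
     (\<exists>b :: nat \<Rightarrow> nat \<Rightarrow> 'a. \<forall>i<n. \<forall>j<n. a i j = (\<Sum>k<n. star (b k i) * b k j))"

definition positive_op_matrix :: "'h hilbert \<Rightarrow> nat \<Rightarrow> (nat \<Rightarrow> nat \<Rightarrow> 'h \<Rightarrow> 'h) \<Rightarrow> bool" where
  "positive_op_matrix H n S \<longleftrightarrow>
     (\<forall>\<xi> \<in> {..<n} \<rightarrow> carrier H. (\<Sum>i<n. \<Sum>j<n. cinner H (\<xi> i) (S i j (\<xi> j))) \<in> \<real>\<^sub>\<ge>\<^sub>0)"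

definition completely_positive :: "'h hilbert \<Rightarrow> ('a::cstar_algebra \<Rightarrow> 'h \<Rightarrow> 'h) \<Rightarrow> bool" where
  "completely_positive H \<phi> \<longleftrightarrow>
     (\<forall>n a. positive_matrix n a \<longrightarrow> positive_op_matrix H n (\<lambda>i j. \<phi> (a i j)))"


section \<open>Categories and functors\<close>

text \<open>
  \<open>Comp C x y z g h\<close> is the composite \<open>g \<circ> h\<close> of \<open>h : x \<rightarrow> y\<close> and \<open>g : y \<rightarrow> z\<close>.
\<close>

record ('o, 'm) category =
  Obj :: "'o set"
  Hom :: "'o \<Rightarrow> 'o \<Rightarrow> 'm set"
  Ident :: "'o \<Rightarrow> 'm"
  Comp :: "'o \<Rightarrow> 'o \<Rightarrow> 'o \<Rightarrow> 'm \<Rightarrow> 'm \<Rightarrow> 'm"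

definition is_category :: "('o, 'm) category \<Rightarrow> bool" where
  "is_category C \<longleftrightarrow>
     (\<forall>x\<in>Obj C. Ident C x \<in> Hom C x x) \<and>
     (\<forall>x\<in>Obj C. \<forall>y\<in>Obj C. \<forall>z\<in>Obj C. \<forall>h\<in>Hom C x y. \<forall>g\<in>Hom C y z.
        Comp C x y z g h \<in> Hom C x z) \<and>
     (\<forall>x\<in>Obj C. \<forall>y\<in>Obj C. \<forall>h\<in>Hom C x y.
        Comp C x x y h (Ident C x) = h \<and> Comp C x y y (Ident C y) h = h) \<and>
     (\<forall>w\<in>Obj C. \<forall>x\<in>Obj C. \<forall>y\<in>Obj C. \<forall>z\<in>Obj C.
        \<forall>h\<in>Hom C w x. \<forall>g\<in>Hom C x y. \<forall>k\<in>Hom C y z.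
          Comp C w x z (Comp C x y z k g) h = Comp C w y z k (Comp C w x y g h))"

text \<open>
  A functor carries its source and target; \<open>mk_functor\<close> makes its object and arrow maps
  \<^term>\<open>undefined\<close> outside the objects and arrows of the source, so that equality of functors is
  equality in HOL.
\<close>

record ('o, 'm, 'p, 'n) cat_functor =
  Src :: "('o, 'm) category"
  Tgt :: "('p, 'n) category"
  FObj :: "'o \<Rightarrow> 'p"
  FArr :: "'o \<Rightarrow> 'o \<Rightarrow> 'm \<Rightarrow> 'n"

definition mk_functor ::
  "('o, 'm) category \<Rightarrow> ('p, 'n) category \<Rightarrow> ('o \<Rightarrow> 'p) \<Rightarrow> ('o \<Rightarrow> 'o \<Rightarrow> 'm \<Rightarrow> 'n) \<Rightarrow>
   ('o, 'm, 'p, 'n) cat_functor" where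
  "mk_functor C D F0 F1 =
     \<lparr>Src = C, Tgt = D, FObj = restrict F0 (Obj C),
      FArr = (\<lambda>x y h. if x \<in> Obj C \<and> y \<in> Obj C \<and> h \<in> Hom C x y then F1 x y h else undefined)\<rparr>"

definition Functors ::
  "('o, 'm) category \<Rightarrow> ('p, 'n) category \<Rightarrow> ('o, 'm, 'p, 'n) cat_functor set" where
  "Functors C D = {F. is_category C \<and> is_category D \<and> F = mk_functor C D (FObj F) (FArr F) \<and>
     (\<forall>x\<in>Obj C. FObj F x \<in> Obj D) \<and>
     (\<forall>x\<in>Obj C. \<forall>y\<in>Obj C. \<forall>h\<in>Hom C x y. FArr F x y h \<in> Hom D (FObj F x) (FObj F y)) \<and>
     (\<forall>x\<in>Obj C. FArr F x x (Ident C x) = Ident D (FObj F x)) \<and>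
     (\<forall>x\<in>Obj C. \<forall>y\<in>Obj C. \<forall>z\<in>Obj C. \<forall>h\<in>Hom C x y. \<forall>g\<in>Hom C y z.
        FArr F x z (Comp C x y z g h) =
        Comp D (FObj F x) (FObj F y) (FObj F z) (FArr F y z g) (FArr F x y h))}"

definition functor_comp ::
  "('p, 'n, 'q, 'l) cat_functor \<Rightarrow> ('o, 'm, 'p, 'n) cat_functor \<Rightarrow> ('o, 'm, 'q, 'l) cat_functor"
  (infixr \<open>\<circ>\<^sub>F\<close> 55) where
  "G \<circ>\<^sub>F F = mk_functor (Src F) (Tgt G) (\<lambda>x. FObj G (FObj F x))
     (\<lambda>x y h. FArr G (FObj F x) (FObj F y) (FArr F x y h))"

text \<open>
  The restriction of a functor to a subcategory \<open>C\<close> of its source, with target corestricted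
  to a subcategory \<open>D\<close>.
\<close>

definition restrict_functor ::
  "('o, 'm, 'p, 'n) cat_functor \<Rightarrow> ('o, 'm) category \<Rightarrow> ('p, 'n) category \<Rightarrow>
   ('o, 'm, 'p, 'n) cat_functor" where
  "restrict_functor F C D = mk_functor C D (FObj F) (FArr F)"


section \<open>Operator-valued completely positive maps\<close>

type_synonym ('a, 'k) ocp = "'k hilbert \<times> ('a \<Rightarrow> 'k \<Rightarrow> 'k)"
type_synonym ('a, 'k) ocp_category = "(('a, 'k) ocp, 'k \<Rightarrow> 'k) category"

definition OCP :: "('a::cstar_algebra, 'k) ocp_category" where
  "OCP = \<lparr>
     Obj = {(K, \<phi>). hilbert_space K \<and> linear_into_ops K \<phi> \<and> completely_positive K \<phi>},
     Hom = (\<lambda>(K, \<phi>) (L, \<psi>). {T \<in> bounded_ops K L.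
       \<forall>a. compose (carrier K) T (\<phi> a) = compose (carrier K) (\<psi> a) T}),
     Ident = (\<lambda>(K, \<phi>). id_op K),
     Comp = (\<lambda>(K, \<phi>) _ _ S T. compose (carrier K) S T)\<rparr>"

definition OpSt :: "('a::cstar_algebra, 'k) ocp_category" where
  "OpSt = \<lparr>
     Obj = {(K, \<phi>) \<in> Obj OCP. \<phi> 1 = id_op K},
     Hom = (\<lambda>(K, \<phi>) (L, \<psi>). Hom OCP (K, \<phi>) (L, \<psi>) \<inter> isometries K L),
     Ident = Ident OCP,
     Comp = Comp OCP\<rparr>"


section \<open>Anchored representations\<close>

type_synonym ('a, 'k, 'h) anrep =
  "'k hilbert \<times> 'h hilbert \<times> ('a \<Rightarrow> 'h \<Rightarrow> 'h) \<times> ('k \<Rightarrow> 'h)"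
type_synonym ('k, 'h) anrep_mor = "('k \<Rightarrow> 'k) \<times> ('h \<Rightarrow> 'h)"
type_synonym ('a, 'k, 'h) anrep_category =
  "(('a, 'k, 'h) anrep, ('k, 'h) anrep_mor) category"

definition AnRep :: "('a::cstar_algebra, 'k, 'h) anrep_category" where
  "AnRep = \<lparr>
     Obj = {(K, H, \<pi>, V). hilbert_space K \<and> hilbert_space H \<and> representation H \<pi> \<and>
       V \<in> bounded_ops K H},
     Hom = (\<lambda>(K, H, \<pi>, V) (L, I, \<rho>, W). {(T, M). T \<in> bounded_ops K L \<and> M \<in> bounded_ops H I \<and>
       (\<forall>a. compose (carrier H) M (\<pi> a) = compose (carrier H) (\<rho> a) M) \<and>
       compose (carrier K) M V = compose (carrier K) W T \<and>
       compose (carrier H) T (adj K H V) = compose (carrier H) (adj L I W) M}),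
     Ident = (\<lambda>(K, H, \<pi>, V). (id_op K, id_op H)),
     Comp = (\<lambda>(K, H, \<pi>, V) _ _ (S, N) (T, M).
       (compose (carrier K) S T, compose (carrier H) N M))\<rparr>"

definition PAnRep :: "('a::cstar_algebra, 'k, 'h) anrep_category" where
  "PAnRep = \<lparr>
     Obj = {(K, H, \<pi>, V) \<in> Obj AnRep. V \<in> isometries K H},
     Hom = (\<lambda>(K, H, \<pi>, V) (L, I, \<rho>, W). {(T, M) \<in> Hom AnRep (K, H, \<pi>, V) (L, I, \<rho>, W).
       T \<in> isometries K L \<and> M \<in> isometries H I}),
     Ident = Ident AnRep,
     Comp = Comp AnRep\<rparr>"


section \<open>The functors\<close>

type_synonym ('a, 'b, 'k) ocp_functor =
  "(('a, 'k) ocp, 'k \<Rightarrow> 'k, ('b, 'k) ocp, 'k \<Rightarrow> 'k) cat_functor"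
type_synonym ('a, 'b, 'k, 'h) anrep_functor =
  "(('a, 'k, 'h) anrep, ('k, 'h) anrep_mor, ('b, 'k, 'h) anrep, ('k, 'h) anrep_mor) cat_functor"
type_synonym ('a, 'k, 'h) rest_functor =
  "(('a, 'k, 'h) anrep, ('k, 'h) anrep_mor, ('a, 'k) ocp, 'k \<Rightarrow> 'k) cat_functor"

definition OCP_map ::
  "('b::cstar_algebra \<Rightarrow> 'a::cstar_algebra) \<Rightarrow> ('a, 'b, 'k) ocp_functor" where
  "OCP_map f = mk_functor OCP OCP (\<lambda>(K, \<phi>). (K, \<phi> \<circ> f)) (\<lambda>_ _ T. T)"

definition OpSt_map ::
  "('b::cstar_algebra \<Rightarrow> 'a::cstar_algebra) \<Rightarrow> ('a, 'b, 'k) ocp_functor" where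
  "OpSt_map f = restrict_functor (OCP_map f) OpSt OpSt"

definition AnRep_map ::
  "('b::cstar_algebra \<Rightarrow> 'a::cstar_algebra) \<Rightarrow> ('a, 'b, 'k, 'h) anrep_functor" where
  "AnRep_map f = mk_functor AnRep AnRep (\<lambda>(K, H, \<pi>, V). (K, H, \<pi> \<circ> f, V)) (\<lambda>_ _ TM. TM)"

definition PAnRep_map ::
  "('b::cstar_algebra \<Rightarrow> 'a::cstar_algebra) \<Rightarrow> ('a, 'b, 'k, 'h) anrep_functor" where
  "PAnRep_map f = restrict_functor (AnRep_map f) PAnRep PAnRep"

definition rest :: "('a::cstar_algebra, 'k, 'h) rest_functor" where
  "rest = mk_functor AnRep OCP
     (\<lambda>(K, H, \<pi>, V).
       (K, \<lambda>a. compose (carrier K) (adj K H V) (compose (carrier K) (\<pi> a) V)))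
     (\<lambda>_ _ (T, M). T)"

definition prest :: "('a::cstar_algebra, 'k, 'h) rest_functor" where
  "prest = restrict_functor rest PAnRep OpSt"

end

theory Submission
  imports Defs
begin

text \<open>
  On the level of formulas both composites send \<open>(K, H, \<pi>, V)\<close> to \<open>(K, V\<^sup>* \<pi>(f(\<cdot>)) V)\<close> and \<open>(T, L)\<close>
  to \<open>T\<close>. The content is that these are functors between the stated categories. This needs the
  adjoint to exist as a bounded operator (Riesz representation). Complete positivity of
  \<open>V\<^sup>* \<pi>(\<cdot>) V\<close> holds because for \<open>a\<^sub>i\<^sub>j = \<Sum>\<^sub>k b\<^sub>k\<^sub>i\<^sup>* b\<^sub>k\<^sub>j\<close> the form
  \<open>\<Sum>\<^sub>i\<^sub>j \<langle>\<xi>\<^sub>i, V\<^sup>* \<pi>(a\<^sub>i\<^sub>j) V \<xi>\<^sub>j\<rangle>\<close> equals \<open>\<Sum>\<^sub>k \<parallel>\<Sum>\<^sub>j \<pi>(b\<^sub>k\<^sub>j) V \<xi>\<^sub>j\<parallel>\<^sup>2\<close>, and \<open>T\<close> intertwines the compressions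
  since \<open>T V\<^sup>* \<pi>(a) V = W\<^sup>* L \<pi>(a) V = W\<^sup>* \<rho>(a) L V = W\<^sup>* \<rho>(a) W T\<close>.
\<close>


section \<open>Inner products\<close>

lemma complex_ring_simps [simp]:
  "carrier complex_ring = UNIV" "mult complex_ring = (*)" "one complex_ring = 1"
  "zero complex_ring = 0" "add complex_ring = (+)"
  by (simp_all add: complex_ring_def)

lemma Re_nonneg_Reals: "z \<in> \<real>\<^sub>\<ge>\<^sub>0 \<Longrightarrow> 0 \<le> Re z"
  by (auto elim: nonneg_Reals_cases)

lemma nonneg_Reals_sum:
  "(\<And>x. x \<in> A \<Longrightarrow> f x \<in> \<real>\<^sub>\<ge>\<^sub>0) \<Longrightarrow> sum f A \<in> \<real>\<^sub>\<ge>\<^sub>0"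
  by (induction A rule: infinite_finite_induct) auto

text \<open>For small \<open>t\<close> of sign opposite to \<open>d\<close> the linear term
  dominates. This is the first-order condition at a minimum, used in the Riesz argument.\<close>

lemma real_quadratic_nonneg_imp_zero:
  fixes d q :: real
  assumes "q \<ge> 0" "\<And>t. 0 \<le> 2 * t * d + t\<^sup>2 * q"
  shows "d = 0"
proof (rule ccontr)
  assume "d \<noteq> 0"
  \<comment> \<open>Dividing by \<open>q + 1\<close> rather than \<open>q\<close> covers
    \<open>q = 0\<close>; the test point is \<open>t = - d / s\<close>.\<close>
  define s where "s = q + 1"
  have s: "s > 0" "q = s - 1" using assms(1) by (auto simp: s_def)
  have "2 * (- d / s) * d + (- d / s)\<^sup>2 * q = - (d\<^sup>2 / s) - (d / s)\<^sup>2"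
    unfolding s(2) using s(1) by (simp add: field_simps power2_eq_square)
  moreover have "d\<^sup>2 / s > 0" using \<open>d \<noteq> 0\<close> s by simp
  ultimately show False using assms(2)[of "- d / s"] zero_le_power2[of "d / s"] by linarith
qed

context hilbert_space
begin

lemma smult_closed_complex [simp]: "x \<in> carrier H \<Longrightarrow> c \<odot> x \<in> carrier H"
  using smult_closed by simp

lemma cinner_zero_right [simp]: "x \<in> carrier H \<Longrightarrow> cinner H x \<zero> = 0"
  using cinner_add_right[of x \<zero> \<zero>] by simp

lemma cinner_minus_right [simp]:
  assumes "x \<in> carrier H" "y \<in> carrier H"
  shows "cinner H x (\<ominus> y) = - cinner H x y"
  using cinner_add_right[of x y "\<ominus> y"] assms by (simp add: r_neg eq_neg_iff_add_eq_0 add.commute)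

lemma cinner_diff_right:
  assumes "x \<in> carrier H" "y \<in> carrier H" "z \<in> carrier H"
  shows "cinner H x (y \<ominus> z) = cinner H x y - cinner H x z"
  using assms by (simp add: a_minus_def cinner_add_right)

lemma cinner_add_left:
  assumes "x \<in> carrier H" "y \<in> carrier H" "z \<in> carrier H"
  shows "cinner H (x \<oplus> y) z = cinner H x z + cinner H y z"
  using assms by (simp add: cinner_commute[of _ z] cinner_add_right)

lemma cinner_diff_left:
  assumes "x \<in> carrier H" "y \<in> carrier H" "z \<in> carrier H"
  shows "cinner H (x \<ominus> y) z = cinner H x z - cinner H y z"
  using assms by (simp add: cinner_commute[of _ z] cinner_diff_right)

lemma cinner_smult_left:
  assumes "x \<in> carrier H" "y \<in> carrier H"
  shows "cinner H (c \<odot> x) y = cnj c * cinner H x y"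
  using assms by (simp add: cinner_commute[of _ y] cinner_smult_right)

lemmas cinner_simps = cinner_add_right cinner_add_left cinner_diff_right cinner_diff_left
  cinner_smult_right cinner_smult_left

lemma Re_cinner_commute:
  "x \<in> carrier H \<Longrightarrow> y \<in> carrier H \<Longrightarrow> Re (cinner H x y) = Re (cinner H y x)"
  using cinner_commute[of x y] by simp

lemma Re_cinner_nonneg: "x \<in> carrier H \<Longrightarrow> 0 \<le> Re (cinner H x x)"
  by (simp add: Re_nonneg_Reals cinner_nonneg)

lemma hnorm_nonneg [simp]: "x \<in> carrier H \<Longrightarrow> 0 \<le> hnorm H x"
  by (simp add: hnorm_def Re_cinner_nonneg)

lemma hnorm_power2: "x \<in> carrier H \<Longrightarrow> (hnorm H x)\<^sup>2 = Re (cinner H x x)"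
  by (simp add: hnorm_def Re_cinner_nonneg)

text \<open>Testing against \<open>z = x \<ominus> y\<close> makes that difference orthogonal to
  itself. All identities between adjoints are proved this way.\<close>

lemma cinner_ext:
  assumes "x \<in> carrier H" "y \<in> carrier H"
    and "\<And>z. z \<in> carrier H \<Longrightarrow> cinner H z x = cinner H z y"
  shows "x = y"
proof -
  have "cinner H (x \<ominus> y) (x \<ominus> y) = 0"
    using assms by (simp add: cinner_diff_right)
  then have "x \<ominus> y = \<zero>" using assms by (intro cinner_eq_zero) auto
  then show ?thesis
    using assms minus_equality[of x "\<ominus> y"] by (simp add: a_minus_def)
qed

text \<open>This expansion along a real line serves both the Cauchy-Schwarz inequality and the
  variation of the functional in the Riesz argument.\<close>

lemma Re_cinner_quadratic:
  assumes "x \<in> carrier H" "y \<in> carrier H"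
  shows "Re (cinner H (x \<oplus> of_real t \<odot> y) (x \<oplus> of_real t \<odot> y)) =
    Re (cinner H x x) + 2 * t * Re (cinner H x y) + t\<^sup>2 * Re (cinner H y y)"
  using assms Re_cinner_commute[of y x]
  by (simp add: cinner_simps algebra_simps power2_eq_square)

text \<open>Cauchy-Schwarz for real parts: the quadratic \<open>q\<close> in \<open>t\<close> is
  nonnegative, and its value at the minimiser \<open>- ?b / ?c\<close> gives the bound. If
  \<open>?c\<close> vanishes then \<open>y\<close> is zero.\<close>

lemma Re_cinner_le:
  assumes "x \<in> carrier H" "y \<in> carrier H"
  shows "\<bar>Re (cinner H x y)\<bar> \<le> hnorm H x * hnorm H y"
proof -
  let ?a = "Re (cinner H x x)" and ?b = "Re (cinner H x y)" and ?c = "Re (cinner H y y)"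
  have q: "0 \<le> ?a + 2 * t * ?b + t\<^sup>2 * ?c" for t
    using Re_cinner_nonneg[of "x \<oplus> of_real t \<odot> y"] Re_cinner_quadratic[OF assms] assms by simp
  have "?b\<^sup>2 \<le> ?a * ?c"
  proof (cases "?c = 0")
    case True
    then have "cinner H y y = 0"
      using cinner_nonneg[OF assms(2)] by (auto elim!: nonneg_Reals_cases)
    then have "y = \<zero>" using cinner_eq_zero assms by blast
    then show ?thesis using assms by simp
  next
    case False
    then have c: "?c > 0" using Re_cinner_nonneg[OF assms(2)] by simp
    have "?a + 2 * (- ?b / ?c) * ?b + (- ?b / ?c)\<^sup>2 * ?c = ?a - ?b\<^sup>2 / ?c"
      using c by (simp add: field_simps power2_eq_square)
    then have "?b\<^sup>2 / ?c \<le> ?a" using q[of "- ?b / ?c"] by simp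
    then show ?thesis using c by (simp add: field_simps)
  qed
  then have "\<bar>?b\<bar>\<^sup>2 \<le> (hnorm H x * hnorm H y)\<^sup>2"
    using assms by (simp add: power_mult_distrib hnorm_power2)
  then show ?thesis by (rule power2_le_imp_le) (simp add: assms)
qed

text \<open>The representing vector minimises \<open>\<parallel>x\<parallel>\<^sup>2 - 2 Re (\<phi> x)\<close>; the parallelogram law makes minimising
  sequences Cauchy.\<close>

lemma riesz_representation:
  assumes add: "\<And>x y. x \<in> carrier H \<Longrightarrow> y \<in> carrier H \<Longrightarrow> \<phi> (x \<oplus> y) = \<phi> x + \<phi> y"
    and smult: "\<And>c x. x \<in> carrier H \<Longrightarrow> \<phi> (c \<odot> x) = c * \<phi> x"
    and bound: "\<And>x. x \<in> carrier H \<Longrightarrow> Re (\<phi> x) \<le> B * hnorm H x"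
  obtains l where "l \<in> carrier H" "\<And>z. z \<in> carrier H \<Longrightarrow> cinner H l z = \<phi> z"
proof -
  \<comment> \<open>For a representing vector \<open>l\<close>, \<open>J x\<close> would be the
    squared norm of \<open>x \<ominus> l\<close> minus that of \<open>l\<close>, so minimising
    \<open>J\<close> finds \<open>l\<close>.\<close>
  define J where "J x = Re (cinner H x x) - 2 * Re (\<phi> x)" for x
  define m where "m = Inf (J ` carrier H)"
  \<comment> \<open>Completing the square in \<open>hnorm H x\<close> gives a lower bound, so the
    infimum \<open>m\<close> is finite.\<close>
  have "- B\<^sup>2 \<le> J x" if "x \<in> carrier H" for x
  proof -
    have "0 \<le> (hnorm H x - B)\<^sup>2" by simp
    also have "\<dots> = Re (cinner H x x) - 2 * (B * hnorm H x) + B\<^sup>2"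
      using that by (simp add: power2_diff hnorm_power2)
    finally show ?thesis using bound[OF that] by (simp add: J_def)
  qed
  then have bdd: "bdd_below (J ` carrier H)" by (intro bdd_belowI[of _ "- B\<^sup>2"]) auto
  have m_le: "m \<le> J x" if "x \<in> carrier H" for x
    unfolding m_def using bdd that by (auto intro: cInf_lower)
  have "\<exists>x\<in>carrier H. J x < m + 1 / real (Suc n)" for n
  proof -
    have ne: "J ` carrier H \<noteq> {}" by (metis image_is_empty empty_iff zero_closed)
    have "Inf (J ` carrier H) < m + 1 / real (Suc n)" by (simp add: m_def)
    then show ?thesis using cInf_less_iff[OF ne bdd] by auto
  qed
  then obtain X where X: "\<And>n. X n \<in> carrier H" "\<And>n. J (X n) < m + 1 / real (Suc n)"
    by metis
  have J_quad: "J (x \<oplus> of_real t \<odot> z) =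
      J x + 2 * t * (Re (cinner H x z) - Re (\<phi> z)) + t\<^sup>2 * Re (cinner H z z)"
    if "x \<in> carrier H" "z \<in> carrier H" for x z t
    using that by (simp add: J_def Re_cinner_quadratic add smult algebra_simps)
  \<comment> \<open>By the parallelogram law the left side is \<open>2 * J x + 2 * J y\<close> minus
    four times \<open>J\<close> at the midpoint, and \<open>J\<close> there is at least
    \<open>m\<close>.\<close>
  have par: "(hnorm H (x \<ominus> y))\<^sup>2 \<le> 2 * (J x - m) + 2 * (J y - m)"
    if "x \<in> carrier H" "y \<in> carrier H" for x y
  proof -
    have "m \<le> J (of_real (1/2) \<odot> (x \<oplus> y))" using that by (intro m_le) simp
    also have "\<dots> = Re (cinner H (x \<oplus> y) (x \<oplus> y)) / 4 - Re (\<phi> (x \<oplus> y))"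
      using that by (simp add: J_def cinner_smult_right cinner_smult_left smult del: of_real_divide)
    finally show ?thesis
      using that by (simp add: J_def hnorm_power2 cinner_simps add algebra_simps)
  qed
  have "\<exists>N. \<forall>i\<ge>N. \<forall>j\<ge>N. hnorm H (X i \<ominus> X j) < e" if "e > 0" for e
  proof -
    \<comment> \<open>Each of the two terms in \<open>par\<close> then contributes less than half of
      \<open>e\<^sup>2\<close>.\<close>
    obtain N where N: "1 / real (Suc N) < e\<^sup>2 / 4"
      using reals_Archimedean[of "e\<^sup>2 / 4"] \<open>e > 0\<close> by (auto simp: inverse_eq_divide)
    have "hnorm H (X i \<ominus> X j) < e" if "i \<ge> N" "j \<ge> N" for i j
    proof -
      have "J (X k) < m + e\<^sup>2 / 4" if "k \<ge> N" for k
      proof -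
        have "1 / real (Suc k) \<le> 1 / real (Suc N)" using that by (intro frac_le) auto
        then show ?thesis using X(2)[of k] N by (simp del: of_nat_Suc)
      qed
      from this[OF \<open>i \<ge> N\<close>] this[OF \<open>j \<ge> N\<close>]
      have "(hnorm H (X i \<ominus> X j))\<^sup>2 < e\<^sup>2"
        using par[OF X(1) X(1), of i j] by (simp add: field_simps)
      then show ?thesis by (rule power2_less_imp_less) (use \<open>e > 0\<close> in simp)
    qed
    then show ?thesis by blast
  qed
  from complete[OF X(1) this] obtain l
    where l: "l \<in> carrier H" "(\<lambda>n. hnorm H (X n \<ominus> l)) \<longlonglongrightarrow> 0" by blast
  \<comment> \<open>Instead of showing that \<open>l\<close> minimises \<open>J\<close>, the
    inequality \<open>J (X n) - 1 / Suc n < m \<le> J (X n \<oplus> t \<odot> z)\<close> is expanded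
    by \<open>J_quad\<close> and passed to the limit. The resulting quadratic in \<open>t\<close>
    has no constant term, so its linear coefficient vanishes.\<close>
  have Re_eq: "Re (cinner H l z) = Re (\<phi> z)" if z: "z \<in> carrier H" for z
  proof -
    have "(\<lambda>n. Re (cinner H (X n) z) - Re (cinner H l z)) \<longlonglongrightarrow> 0"
    proof (rule tendsto_0_le[OF l(2)])
      have "\<bar>Re (cinner H (X n) z) - Re (cinner H l z)\<bar> \<le> hnorm H (X n \<ominus> l) * hnorm H z" for n
        using Re_cinner_le[of "X n \<ominus> l" z] z l(1) X(1) by (simp add: cinner_diff_left)
      then show "\<forall>\<^sub>F n in sequentially. norm (Re (cinner H (X n) z) - Re (cinner H l z))
          \<le> norm (hnorm H (X n \<ominus> l)) * hnorm H z"
        using l(1) X(1) by simp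
    qed
    then have lim: "(\<lambda>n. Re (cinner H (X n) z)) \<longlonglongrightarrow> Re (cinner H l z)"
      by (rule LIM_zero_cancel)
    have "0 \<le> 2 * t * (Re (cinner H l z) - Re (\<phi> z)) + t\<^sup>2 * Re (cinner H z z)" for t
    proof -
      have "(\<lambda>n. 1 / real (Suc n) + (2 * t * (Re (cinner H (X n) z) - Re (\<phi> z)) +
            t\<^sup>2 * Re (cinner H z z))) \<longlonglongrightarrow>
          0 + (2 * t * (Re (cinner H l z) - Re (\<phi> z)) + t\<^sup>2 * Re (cinner H z z))"
        by (intro tendsto_intros lim LIMSEQ_Suc[OF lim_1_over_n])
      moreover have "0 \<le> 1 / real (Suc n) + (2 * t * (Re (cinner H (X n) z) - Re (\<phi> z)) +
            t\<^sup>2 * Re (cinner H z z))" for n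
        using m_le[of "X n \<oplus> of_real t \<odot> z"] J_quad[OF X(1) z] X[of n] z by fastforce
      ultimately show ?thesis by (auto dest: LIMSEQ_le_const)
    qed
    then show ?thesis
      using real_quadratic_nonneg_imp_zero[OF Re_cinner_nonneg[OF z]] by fastforce
  qed
  have "cinner H l z = \<phi> z" if z: "z \<in> carrier H" for z
  proof (rule complex_eqI)
    show "Re (cinner H l z) = Re (\<phi> z)" by (rule Re_eq[OF z])
    \<comment> \<open>Both sides are complex linear in \<open>z\<close>, so the real parts at
      \<open>\<i> \<odot> z\<close> are the negated imaginary parts at \<open>z\<close>.\<close>
    show "Im (cinner H l z) = Im (\<phi> z)"
      using Re_eq[of "\<i> \<odot> z"] z l(1) by (simp add: cinner_smult_right smult)
  qed
  then show thesis using l(1) that by blast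
qed

text \<open>The double sum is the inner product with itself of the vector sum \<open>v\<close> of
  the \<open>\<eta> j\<close>.\<close>

lemma cinner_double_sum_nonneg:
  fixes n :: nat
  assumes "\<eta> \<in> {..<n} \<rightarrow> carrier H"
  shows "(\<Sum>i<n. \<Sum>j<n. cinner H (\<eta> i) (\<eta> j)) \<in> \<real>\<^sub>\<ge>\<^sub>0"
proof -
  \<comment> \<open>The vector \<open>v\<close> is built by induction and recorded only through its
    inner products on both sides, which is all that the computation uses.\<close>
  have "\<exists>v\<in>carrier H. (\<forall>z\<in>carrier H. cinner H z v = (\<Sum>j<n. cinner H z (\<eta> j))) \<and>
      (\<forall>z\<in>carrier H. cinner H v z = (\<Sum>j<n. cinner H (\<eta> j) z))"
    using assms
  proof (induction n)
    case 0
    have "cinner H \<zero> z = 0" if "z \<in> carrier H" for z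
      using cinner_commute[of \<zero> z] that by simp
    then show ?case by (intro bexI[of _ \<zero>]) auto
  next
    case (Suc n)
    then obtain v where v: "v \<in> carrier H"
      "\<And>z. z \<in> carrier H \<Longrightarrow> cinner H z v = (\<Sum>j<n. cinner H z (\<eta> j))"
      "\<And>z. z \<in> carrier H \<Longrightarrow> cinner H v z = (\<Sum>j<n. cinner H (\<eta> j) z)"
      by (force simp: Pi_iff)
    moreover have "\<eta> n \<in> carrier H" using Suc.prems by auto
    ultimately show ?case
      by (intro bexI[of _ "v \<oplus> \<eta> n"]) (auto simp: cinner_add_right cinner_add_left)
  qed
  then obtain v where v: "v \<in> carrier H"
    "\<And>z. z \<in> carrier H \<Longrightarrow> cinner H z v = (\<Sum>j<n. cinner H z (\<eta> j))"
    "\<And>z. z \<in> carrier H \<Longrightarrow> cinner H v z = (\<Sum>j<n. cinner H (\<eta> j) z)" by blast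
  have "(\<Sum>i<n. \<Sum>j<n. cinner H (\<eta> i) (\<eta> j)) = (\<Sum>i<n. cinner H (\<eta> i) v)"
    using assms by (intro sum.cong refl v(2)[symmetric]) auto
  also have "\<dots> = cinner H v v" using v(1,3) by simp
  finally show ?thesis using cinner_nonneg[OF v(1)] by simp
qed

end


section \<open>Bounded operators and adjoints\<close>

lemma compose_eq_iff: "compose A f g = compose A h k \<longleftrightarrow> (\<forall>x\<in>A. f (g x) = h (k x))"
  by (auto simp: compose_def restrict_def fun_eq_iff)

lemma bounded_opsD:
  assumes "T \<in> bounded_ops H I"
  shows "T \<in> carrier H \<rightarrow>\<^sub>E carrier I"
    and "x \<in> carrier H \<Longrightarrow> T x \<in> carrier I"
    and "x \<in> carrier H \<Longrightarrow> y \<in> carrier H \<Longrightarrow> T (x \<oplus>\<^bsub>H\<^esub> y) = T x \<oplus>\<^bsub>I\<^esub> T y"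
    and "x \<in> carrier H \<Longrightarrow> T (c \<odot>\<^bsub>H\<^esub> x) = c \<odot>\<^bsub>I\<^esub> T x"
  using assms by (auto simp: bounded_ops_def)

text \<open>The bound in \<open>bounded_ops\<close> may be negative, for instance on the zero space.
  Replacing it by \<open>max B 0\<close> makes multiplication by it monotone.\<close>

lemma bounded_ops_bound:
  assumes "hilbert_space H" "T \<in> bounded_ops H I"
  obtains B where "B \<ge> 0" "\<And>x. x \<in> carrier H \<Longrightarrow> hnorm I (T x) \<le> B * hnorm H x"
proof -
  obtain B where B: "\<And>x. x \<in> carrier H \<Longrightarrow> hnorm I (T x) \<le> B * hnorm H x"
    using assms(2) unfolding bounded_ops_def by blast
  have "hnorm I (T x) \<le> max B 0 * hnorm H x" if "x \<in> carrier H" for x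
    using B[OF that] mult_right_mono[of B "max B 0" "hnorm H x"]
      hilbert_space.hnorm_nonneg[OF assms(1) that] by linarith
  then show thesis using that[of "max B 0"] by simp
qed

lemma bounded_opsI:
  assumes "T \<in> carrier H \<rightarrow>\<^sub>E carrier I"
    and "\<And>x y. x \<in> carrier H \<Longrightarrow> y \<in> carrier H \<Longrightarrow> T (x \<oplus>\<^bsub>H\<^esub> y) = T x \<oplus>\<^bsub>I\<^esub> T y"
    and "\<And>c x. x \<in> carrier H \<Longrightarrow> T (c \<odot>\<^bsub>H\<^esub> x) = c \<odot>\<^bsub>I\<^esub> T x"
    and "\<And>x. x \<in> carrier H \<Longrightarrow> hnorm I (T x) \<le> B * hnorm H x"
  shows "T \<in> bounded_ops H I"
  using assms unfolding bounded_ops_def by blast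

lemma compose_bounded_ops:
  assumes "hilbert_space H" "hilbert_space I"
    and T: "T \<in> bounded_ops H I" and S: "S \<in> bounded_ops I J"
  shows "compose (carrier H) S T \<in> bounded_ops H J"
proof -
  interpret H: hilbert_space H by fact
  obtain B where B: "B \<ge> 0" "\<And>x. x \<in> carrier H \<Longrightarrow> hnorm I (T x) \<le> B * hnorm H x"
    using bounded_ops_bound[OF assms(1) T] by blast
  obtain C where C: "C \<ge> 0" "\<And>x. x \<in> carrier I \<Longrightarrow> hnorm J (S x) \<le> C * hnorm I x"
    using bounded_ops_bound[OF assms(2) S] by blast
  show ?thesis
  proof (rule bounded_opsI[where B = "C * B"])
    show "compose (carrier H) S T \<in> carrier H \<rightarrow>\<^sub>E carrier J"
      using bounded_opsD(2)[OF T] bounded_opsD(2)[OF S] by (auto simp: compose_def)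
    show "hnorm J (compose (carrier H) S T x) \<le> C * B * hnorm H x" if "x \<in> carrier H" for x
    proof -
      have "hnorm J (S (T x)) \<le> C * hnorm I (T x)"
        using C(2) bounded_opsD(2)[OF T that] by blast
      also have "\<dots> \<le> C * (B * hnorm H x)"
        using B(2)[OF that] C(1) by (rule mult_left_mono)
      finally show ?thesis using that by (simp add: compose_eq mult.assoc)
    qed
  qed (simp_all add: compose_eq bounded_opsD[OF T] bounded_opsD[OF S])
qed

lemma id_op_simp [simp]: "x \<in> carrier H \<Longrightarrow> id_op H x = x"
  by (simp add: id_op_def)

lemma id_op_bounded_ops:
  assumes "hilbert_space H" shows "id_op H \<in> bounded_ops H H"
proof -
  interpret H: hilbert_space H by fact
  show ?thesis
    by (rule bounded_opsI[where B = 1]) (auto simp: id_op_def)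
qed

lemma id_op_compose: "T \<in> bounded_ops H I \<Longrightarrow> compose (carrier H) (id_op I) T = T"
  unfolding id_op_def by (rule Id_compose) (auto simp: bounded_ops_def PiE_def)

lemma compose_id_op: "T \<in> bounded_ops H I \<Longrightarrow> compose (carrier H) T (id_op H) = T"
  unfolding id_op_def by (rule compose_Id) (auto simp: bounded_ops_def PiE_def)

lemma compose_bounded_ops_assoc:
  assumes "T \<in> bounded_ops H I"
  shows "compose (carrier H) (compose (carrier I) R S) T = compose (carrier H) R (compose (carrier H) S T)"
  using bounded_opsD(2)[OF assms] compose_assoc[of T "carrier H" "carrier I" R S] by auto

section \<open>Isometries, polarization and adjoints\<close>

lemma isometriesD:
  assumes "T \<in> isometries H I"
  shows "T \<in> bounded_ops H I" "x \<in> carrier H \<Longrightarrow> hnorm I (T x) = hnorm H x"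
  using assms by (auto simp: isometries_def)

lemma id_op_isometries: "hilbert_space H \<Longrightarrow> id_op H \<in> isometries H H"
  by (simp add: isometries_def id_op_bounded_ops)

lemma compose_isometries:
  assumes "hilbert_space H" "hilbert_space I" "T \<in> isometries H I" "S \<in> isometries I J"
  shows "compose (carrier H) S T \<in> isometries H J"
  using assms compose_bounded_ops[of H I T S J] bounded_opsD(2)[of T H I]
  by (simp add: isometries_def compose_eq)

text \<open>Polarization: norms of \<open>u \<oplus> v\<close> determine the real parts of inner
  products, and replacing \<open>y\<close> by \<open>\<i> \<odot> y\<close> gives the imaginary
  parts.\<close>

lemma isometry_cinner:
  assumes "hilbert_space H" "hilbert_space I" "T \<in> isometries H I"
    and x: "x \<in> carrier H" and y: "y \<in> carrier H"
  shows "cinner I (T x) (T y) = cinner H x y"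
proof -
  interpret H: hilbert_space H by fact
  interpret I: hilbert_space I by fact
  note T = bounded_opsD[OF isometriesD(1)[OF assms(3)]]
  have N: "Re (cinner I (T u) (T u)) = Re (cinner H u u)" if "u \<in> carrier H" for u
    using isometriesD(2)[OF assms(3) that] that T(2)[OF that]
      H.hnorm_power2[OF that] I.hnorm_power2[of "T u"] by simp
  have R: "Re (cinner I (T u) (T v)) = Re (cinner H u v)"
    if "u \<in> carrier H" "v \<in> carrier H" for u v
    using N[of "u \<oplus>\<^bsub>H\<^esub> v"] N[of u] N[of v] that T
      H.Re_cinner_commute[of u v] I.Re_cinner_commute[of "T u" "T v"]
    by (simp add: H.cinner_simps I.cinner_simps)
  show ?thesis
    using R[OF x y] R[of x "\<i> \<odot>\<^bsub>H\<^esub> y"] x y T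
    by (intro complex_eqI) (simp_all add: H.cinner_simps I.cinner_simps)
qed

text \<open>The definite description in \<open>adj\<close> denotes a vector: existence is the Riesz
  representation of the functional sending \<open>z\<close> to \<open>cinner I y (T z)\<close>,
  bounded by Cauchy-Schwarz, and uniqueness is \<open>cinner_ext\<close>.\<close>

lemma
  assumes "hilbert_space H" "hilbert_space I" and T: "T \<in> bounded_ops H I" and y: "y \<in> carrier I"
  shows adj_closed: "adj H I T y \<in> carrier H"
    and cinner_adj: "z \<in> carrier H \<Longrightarrow> cinner H z (adj H I T y) = cinner I (T z) y"
proof -
  interpret H: hilbert_space H by fact
  interpret I: hilbert_space I by fact
  note TD = bounded_opsD[OF T]
  obtain B where B: "B \<ge> 0" "\<And>x. x \<in> carrier H \<Longrightarrow> hnorm I (T x) \<le> B * hnorm H x"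
    using bounded_ops_bound[OF assms(1) T] by blast
  have "Re (cinner I y (T x)) \<le> (hnorm I y * B) * hnorm H x" if "x \<in> carrier H" for x
  proof -
    have "Re (cinner I y (T x)) \<le> hnorm I y * hnorm I (T x)"
      using I.Re_cinner_le[OF y TD(2)[OF that]] by linarith
    also have "\<dots> \<le> hnorm I y * (B * hnorm H x)"
      using B(2)[OF that] y by (intro mult_left_mono) auto
    finally show ?thesis by (simp add: mult.assoc)
  qed
  then obtain l where l: "l \<in> carrier H"
    "\<And>z. z \<in> carrier H \<Longrightarrow> cinner H l z = cinner I y (T z)"
    using H.riesz_representation[where \<phi> = "\<lambda>z. cinner I y (T z)" and B = "hnorm I y * B"]
      y TD by (auto simp: I.cinner_simps)
  \<comment> \<open>Riesz puts the representing vector in the first slot and \<open>adj\<close> in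
    the second; conjugation exchanges them.\<close>
  have l': "cinner H z l = cinner I (T z) y" if "z \<in> carrier H" for z
    using l that y TD(2)[OF that] H.cinner_commute[of z l] I.cinner_commute[of "T z" y] by simp
  have "adj H I T y = l"
    unfolding adj_def using y l(1) l'
    by (auto intro!: the_equality H.cinner_ext)
  then show "adj H I T y \<in> carrier H"
    and "z \<in> carrier H \<Longrightarrow> cinner H z (adj H I T y) = cinner I (T z) y"
    using l(1) l' by auto
qed

text \<open>Linearity is tested against all vectors. A bound \<open>B\<close> for \<open>T\<close>
  also bounds the adjoint: with \<open>?x\<close> the adjoint applied to \<open>y\<close>, the
  squared norm of \<open>?x\<close> is the real part of \<open>cinner I (T ?x) y\<close>, and one
  factor \<open>hnorm H ?x\<close> cancels.\<close>

lemma adj_bounded_ops: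
  assumes "hilbert_space H" "hilbert_space I" and T: "T \<in> bounded_ops H I"
  shows "adj H I T \<in> bounded_ops I H"
proof -
  interpret H: hilbert_space H by fact
  interpret I: hilbert_space I by fact
  note TD = bounded_opsD[OF T]
  note adj = adj_closed[OF assms] cinner_adj[OF assms]
  obtain B where B: "B \<ge> 0" "\<And>x. x \<in> carrier H \<Longrightarrow> hnorm I (T x) \<le> B * hnorm H x"
    using bounded_ops_bound[OF assms(1) T] by blast
  show ?thesis
  proof (rule bounded_opsI)
    show "adj H I T \<in> carrier I \<rightarrow>\<^sub>E carrier H"
      using adj(1) by (auto simp: adj_def)
    show "adj H I T (x \<oplus>\<^bsub>I\<^esub> y) = adj H I T x \<oplus>\<^bsub>H\<^esub> adj H I T y"
      if "x \<in> carrier I" "y \<in> carrier I" for x y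
      using that adj TD by (intro H.cinner_ext) (simp_all add: H.cinner_simps I.cinner_simps)
    show "adj H I T (c \<odot>\<^bsub>I\<^esub> x) = c \<odot>\<^bsub>H\<^esub> adj H I T x" if "x \<in> carrier I" for c x
      using that adj TD by (intro H.cinner_ext) (simp_all add: H.cinner_simps I.cinner_simps)
    show "hnorm H (adj H I T y) \<le> B * hnorm I y" if y: "y \<in> carrier I" for y
    proof -
      let ?x = "adj H I T y"
      have x: "?x \<in> carrier H" using adj(1)[OF y] .
      have "hnorm H ?x * hnorm H ?x = Re (cinner I (T ?x) y)"
        using H.hnorm_power2[OF x] adj(2)[OF y x] by (simp add: power2_eq_square)
      also have "\<dots> \<le> hnorm I (T ?x) * hnorm I y"
        using I.Re_cinner_le[OF TD(2)[OF x] y] by linarith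
      also have "\<dots> \<le> (B * hnorm H ?x) * hnorm I y"
        using B(2)[OF x] y by (intro mult_right_mono) auto
      finally have "hnorm H ?x * hnorm H ?x \<le> hnorm H ?x * (B * hnorm I y)"
        by (simp add: mult_ac)
      then show ?thesis
        using H.hnorm_nonneg[OF x] I.hnorm_nonneg[OF y] B(1)
        \<comment> \<open>When the factor to cancel is zero, the claim follows from
          \<open>B \<ge> 0\<close>.\<close>
        by (cases "hnorm H ?x = 0") auto
    qed
  qed
qed

text \<open>An isometry preserves inner products, so \<open>x\<close> itself satisfies the defining
  property of the adjoint at \<open>T x\<close>. This is what makes \<open>prest\<close> land in
  unital maps.\<close>

lemma adj_isometry:
  assumes "hilbert_space H" "hilbert_space I" and T: "T \<in> isometries H I" and x: "x \<in> carrier H"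
  shows "adj H I T (T x) = x"
proof -
  interpret H: hilbert_space H by fact
  note T' = isometriesD(1)[OF T]
  have "T x \<in> carrier I" using bounded_opsD(2)[OF T' x] .
  note adj = adj_closed[OF assms(1,2) T' this] cinner_adj[OF assms(1,2) T' this]
  show ?thesis
    using adj x isometry_cinner[OF assms(1-3)] by (intro H.cinner_ext) auto
qed


section \<open>Completely positive maps\<close>

lemma linear_into_opsD:
  assumes "linear_into_ops H \<phi>"
  shows "\<phi> a \<in> bounded_ops H H"
    and "x \<in> carrier H \<Longrightarrow> \<phi> (a + b) x = \<phi> a x \<oplus>\<^bsub>H\<^esub> \<phi> b x"
    and "x \<in> carrier H \<Longrightarrow> \<phi> (c *\<^sub>c a) x = c \<odot>\<^bsub>H\<^esub> \<phi> a x"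
  using assms by (auto simp: linear_into_ops_def)

lemma representationD:
  assumes "representation H \<pi>"
  shows "linear_into_ops H \<pi>"
    and "x \<in> carrier H \<Longrightarrow> \<pi> (a * b) x = \<pi> a (\<pi> b x)"
    and "x \<in> carrier H \<Longrightarrow> \<pi> 1 x = x"
    and "\<pi> (star a) = adj H H (\<pi> a)"
  using assms by (auto simp: representation_def compose_eq)

text \<open>For fixed \<open>x\<close> and \<open>y\<close> the matrix coefficient is an additive
  map from the algebra to the complex numbers, so finite sums pass through it without forming sums
  of vectors in the carrier.\<close>

lemma cinner_linear_into_ops_sum:
  assumes "hilbert_space H" "linear_into_ops H \<pi>" "x \<in> carrier H" "y \<in> carrier H"
  shows "cinner H x (\<pi> (sum a A) y) = (\<Sum>k\<in>A. cinner H x (\<pi> (a k) y))"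
proof -
  interpret H: hilbert_space H by fact
  interpret additive "\<lambda>a. cinner H x (\<pi> a y)"
    using assms linear_into_opsD(2)[OF assms(2)] bounded_opsD(2)[OF linear_into_opsD(1)[OF assms(2)]]
    by unfold_locales (simp add: H.cinner_add_right)
  show ?thesis by (rule sum)
qed

lemma cinner_representation_star_mult:
  assumes "hilbert_space H" "representation H \<pi>" "x \<in> carrier H" "y \<in> carrier H"
  shows "cinner H x (\<pi> (star b * c) y) = cinner H (\<pi> b x) (\<pi> c y)"
proof -
  note op = linear_into_opsD(1)[OF representationD(1)[OF assms(2)]]
  show ?thesis
    using cinner_adj[OF assms(1,1) op bounded_opsD(2)[OF op assms(4)] assms(3)]
      representationD(2,4)[OF assms(2)] assms(4) by simp
qed

lemma linear_into_ops_compression: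
  assumes "hilbert_space K" "hilbert_space H" "linear_into_ops H \<pi>" and V: "V \<in> bounded_ops K H"
  shows "linear_into_ops K (\<lambda>a. compose (carrier K) (adj K H V) (compose (carrier K) (\<pi> a) V))"
proof -
  note \<pi> = linear_into_opsD[OF assms(3)]
  note adj = adj_bounded_ops[OF assms(1,2) V]
  have "compose (carrier K) (adj K H V) (compose (carrier K) (\<pi> a) V) \<in> bounded_ops K K" for a
    by (intro compose_bounded_ops[OF assms(1,2)] V \<pi> adj)
  then show ?thesis
    using \<pi>(2,3) bounded_opsD[OF adj] bounded_opsD(2)[OF V] bounded_opsD(2)[OF \<pi>(1)]
    by (simp add: linear_into_ops_def compose_eq)
qed

lemma completely_positive_compression:
  fixes \<pi> :: "'a::cstar_algebra \<Rightarrow> 'h \<Rightarrow> 'h"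
  assumes "hilbert_space K" "hilbert_space H" "representation H \<pi>" and V: "V \<in> bounded_ops K H"
  shows "completely_positive K (\<lambda>a. compose (carrier K) (adj K H V) (compose (carrier K) (\<pi> a) V))"
  unfolding completely_positive_def positive_op_matrix_def
proof (intro allI impI ballI)
  fix n and a :: "nat \<Rightarrow> nat \<Rightarrow> 'a" and \<xi>
  assume "positive_matrix n a" and \<xi>: "\<xi> \<in> {..<n} \<rightarrow> carrier K"
  then obtain b where b: "\<And>i j. i < n \<Longrightarrow> j < n \<Longrightarrow> a i j = (\<Sum>k<n. star (b k i) * b k j)"
    unfolding positive_matrix_def by blast
  interpret H: hilbert_space H by fact
  note lin = representationD(1)[OF assms(3)]
  note \<pi> = linear_into_opsD(1)[OF lin]
  have \<xi>': "\<xi> i \<in> carrier K" "V (\<xi> i) \<in> carrier H" if "i < n" for i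
    using \<xi> that bounded_opsD(2)[OF V] by auto
  \<comment> \<open>For each fixed \<open>k\<close> these vectors form one family, whose Gram sum is
    nonnegative.\<close>
  let ?\<eta> = "\<lambda>k i. \<pi> (b k i) (V (\<xi> i))"
  \<comment> \<open>The adjoint moves \<open>V\<close> onto \<open>\<xi> i\<close>, and then each
    \<open>star (b k i)\<close> moves \<open>\<pi> (b k i)\<close> into the first slot.\<close>
  have entry: "cinner K (\<xi> i) (compose (carrier K) (adj K H V) (compose (carrier K) (\<pi> (a i j)) V) (\<xi> j))
      = (\<Sum>k<n. cinner H (?\<eta> k i) (?\<eta> k j))" if "i < n" "j < n" for i j
    using that \<xi>' cinner_adj[OF assms(1,2) V] bounded_opsD(2)[OF \<pi>] b[OF that]
    by (simp add: compose_eq cinner_linear_into_ops_sum[OF assms(2) lin]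
        cinner_representation_star_mult[OF assms(2,3)])
  have "(\<Sum>i<n. \<Sum>j<n. cinner K (\<xi> i) (compose (carrier K) (adj K H V) (compose (carrier K) (\<pi> (a i j)) V) (\<xi> j)))
      = (\<Sum>i<n. \<Sum>j<n. \<Sum>k<n. cinner H (?\<eta> k i) (?\<eta> k j))"
    by (intro sum.cong refl entry) auto
  \<comment> \<open>Two exchanges bring \<open>k\<close> outermost, leaving a sum of Gram
    sums.\<close>
  also have "\<dots> = (\<Sum>i<n. \<Sum>k<n. \<Sum>j<n. cinner H (?\<eta> k i) (?\<eta> k j))"
    by (intro sum.cong refl sum.swap)
  also have "\<dots> = (\<Sum>k<n. \<Sum>i<n. \<Sum>j<n. cinner H (?\<eta> k i) (?\<eta> k j))"
    by (rule sum.swap)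
  also have "\<dots> \<in> \<real>\<^sub>\<ge>\<^sub>0"
    using \<xi>' bounded_opsD(2)[OF \<pi>]
    by (intro nonneg_Reals_sum H.cinner_double_sum_nonneg) auto
  finally show "(\<Sum>i<n. \<Sum>j<n. cinner K (\<xi> i) (compose (carrier K) (adj K H V) (compose (carrier K) (\<pi> (a i j)) V) (\<xi> j)))
      \<in> \<real>\<^sub>\<ge>\<^sub>0" .
qed

section \<open>Pulling back along a star homomorphism\<close>

lemma star_homD:
  assumes "star_hom f"
  shows "f (x + y) = f x + f y" "f (c *\<^sub>c x) = c *\<^sub>c f x" "f (x * y) = f x * f y" "f 1 = 1"
    "f (star x) = star (f x)"
  using assms by (auto simp: star_hom_def)

text \<open>Applying \<open>f\<close> to each entry of the factor \<open>b\<close> factors the image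
  matrix. Hence precomposition with \<open>f\<close> preserves complete positivity.\<close>

lemma positive_matrix_star_hom:
  assumes "star_hom f" "positive_matrix n a"
  shows "positive_matrix n (\<lambda>i j. f (a i j))"
proof -
  obtain b where b: "\<And>i j. i < n \<Longrightarrow> j < n \<Longrightarrow> a i j = (\<Sum>k<n. star (b k i) * b k j)"
    using assms(2) unfolding positive_matrix_def by blast
  interpret additive f by unfold_locales (rule star_homD[OF assms(1)])
  show ?thesis
    unfolding positive_matrix_def
    by (intro exI[of _ "\<lambda>i j. f (b i j)"]) (simp add: b sum star_homD[OF assms(1)])
qed

lemma linear_into_ops_star_hom:
  "star_hom f \<Longrightarrow> linear_into_ops K \<phi> \<Longrightarrow> linear_into_ops K (\<phi> \<circ> f)"
  by (simp add: linear_into_ops_def star_homD)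

lemma completely_positive_star_hom:
  "star_hom f \<Longrightarrow> completely_positive K \<phi> \<Longrightarrow> completely_positive K (\<phi> \<circ> f)"
  using positive_matrix_star_hom unfolding completely_positive_def comp_def by blast

lemma representation_star_hom:
  "star_hom f \<Longrightarrow> representation H \<pi> \<Longrightarrow> representation H (\<pi> \<circ> f)"
  using linear_into_ops_star_hom[of f H \<pi>] by (simp add: representation_def star_homD)


section \<open>Functors\<close>

lemma is_categoryI:
  assumes "\<And>x. x \<in> Obj C \<Longrightarrow> Ident C x \<in> Hom C x x"
    and "\<And>x y z h g. \<lbrakk>x \<in> Obj C; y \<in> Obj C; z \<in> Obj C; h \<in> Hom C x y; g \<in> Hom C y z\<rbrakk>
      \<Longrightarrow> Comp C x y z g h \<in> Hom C x z"
    and "\<And>x y h. \<lbrakk>x \<in> Obj C; y \<in> Obj C; h \<in> Hom C x y\<rbrakk> \<Longrightarrow> Comp C x x y h (Ident C x) = h"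
    and "\<And>x y h. \<lbrakk>x \<in> Obj C; y \<in> Obj C; h \<in> Hom C x y\<rbrakk> \<Longrightarrow> Comp C x y y (Ident C y) h = h"
    and "\<And>w x y z h g k. \<lbrakk>w \<in> Obj C; x \<in> Obj C; y \<in> Obj C; z \<in> Obj C;
        h \<in> Hom C w x; g \<in> Hom C x y; k \<in> Hom C y z\<rbrakk>
      \<Longrightarrow> Comp C w x z (Comp C x y z k g) h = Comp C w y z k (Comp C w x y g h)"
  shows "is_category C"
  unfolding is_category_def using assms by (intro conjI ballI) auto

lemma is_categoryD:
  assumes "is_category C"
  shows "x \<in> Obj C \<Longrightarrow> Ident C x \<in> Hom C x x"
    and "\<lbrakk>x \<in> Obj C; y \<in> Obj C; z \<in> Obj C; h \<in> Hom C x y; g \<in> Hom C y z\<rbrakk>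
      \<Longrightarrow> Comp C x y z g h \<in> Hom C x z"
    and "\<lbrakk>x \<in> Obj C; y \<in> Obj C; h \<in> Hom C x y\<rbrakk> \<Longrightarrow> Comp C x x y h (Ident C x) = h"
    and "\<lbrakk>x \<in> Obj C; y \<in> Obj C; h \<in> Hom C x y\<rbrakk> \<Longrightarrow> Comp C x y y (Ident C y) h = h"
    and "\<lbrakk>w \<in> Obj C; x \<in> Obj C; y \<in> Obj C; z \<in> Obj C;
        h \<in> Hom C w x; g \<in> Hom C x y; k \<in> Hom C y z\<rbrakk>
      \<Longrightarrow> Comp C w x z (Comp C x y z k g) h = Comp C w y z k (Comp C w x y g h)"
  using assms unfolding is_category_def by simp_all

lemma mk_functor_simps [simp]:
  "Src (mk_functor C D F0 F1) = C" "Tgt (mk_functor C D F0 F1) = D"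
  "x \<in> Obj C \<Longrightarrow> FObj (mk_functor C D F0 F1) x = F0 x"
  "\<lbrakk>x \<in> Obj C; y \<in> Obj C; h \<in> Hom C x y\<rbrakk> \<Longrightarrow> FArr (mk_functor C D F0 F1) x y h = F1 x y h"
  by (simp_all add: mk_functor_def)

text \<open>Values off the objects and arrows of \<open>C\<close> are overwritten by
  \<open>undefined\<close>, so agreement on these already gives equality of the records. Every
  equality of functors is reduced to this.\<close>

lemma mk_functor_cong:
  assumes "\<And>x. x \<in> Obj C \<Longrightarrow> F0 x = G0 x"
    and "\<And>x y h. \<lbrakk>x \<in> Obj C; y \<in> Obj C; h \<in> Hom C x y\<rbrakk> \<Longrightarrow> F1 x y h = G1 x y h"
  shows "mk_functor C D F0 F1 = mk_functor C D G0 G1"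
  using assms unfolding mk_functor_def by (auto intro!: restrict_ext ext)

text \<open>The laws may be checked on the raw maps \<open>F0\<close> and \<open>F1\<close>:
  identities and composites are again arrows of \<open>C\<close>, where restriction changes
  nothing.\<close>

lemma mk_functor_in_Functors:
  assumes "is_category C" "is_category D"
    and "\<And>x. x \<in> Obj C \<Longrightarrow> F0 x \<in> Obj D"
    and "\<And>x y h. \<lbrakk>x \<in> Obj C; y \<in> Obj C; h \<in> Hom C x y\<rbrakk> \<Longrightarrow> F1 x y h \<in> Hom D (F0 x) (F0 y)"
    and "\<And>x. x \<in> Obj C \<Longrightarrow> F1 x x (Ident C x) = Ident D (F0 x)"
    and "\<And>x y z h g. \<lbrakk>x \<in> Obj C; y \<in> Obj C; z \<in> Obj C; h \<in> Hom C x y; g \<in> Hom C y z\<rbrakk>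
      \<Longrightarrow> F1 x z (Comp C x y z g h) = Comp D (F0 x) (F0 y) (F0 z) (F1 y z g) (F1 x y h)"
  shows "mk_functor C D F0 F1 \<in> Functors C D"
  unfolding Functors_def
  using assms is_categoryD(1,2)[OF assms(1)] by (auto intro!: mk_functor_cong)

lemma FunctorsD:
  assumes "F \<in> Functors C D"
  shows "is_category C" "is_category D" "Src F = C" "Tgt F = D"
    and "x \<in> Obj C \<Longrightarrow> FObj F x \<in> Obj D"
    and "\<lbrakk>x \<in> Obj C; y \<in> Obj C; h \<in> Hom C x y\<rbrakk> \<Longrightarrow> FArr F x y h \<in> Hom D (FObj F x) (FObj F y)"
    and "x \<in> Obj C \<Longrightarrow> FArr F x x (Ident C x) = Ident D (FObj F x)"
    and "\<lbrakk>x \<in> Obj C; y \<in> Obj C; z \<in> Obj C; h \<in> Hom C x y; g \<in> Hom C y z\<rbrakk> \<Longrightarrow>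
      FArr F x z (Comp C x y z g h) =
      Comp D (FObj F x) (FObj F y) (FObj F z) (FArr F y z g) (FArr F x y h)"
proof -
  have "F = mk_functor C D (FObj F) (FArr F)" using assms by (simp add: Functors_def)
  then show "Src F = C" "Tgt F = D" by (metis mk_functor_simps(1,2))+
qed (use assms in \<open>simp_all add: Functors_def\<close>)

lemma functor_comp_in_Functors:
  assumes "F \<in> Functors C D" "G \<in> Functors D E"
  shows "G \<circ>\<^sub>F F \<in> Functors C E"
  unfolding functor_comp_def FunctorsD(3)[OF assms(1)] FunctorsD(4)[OF assms(2)]
  by (rule mk_functor_in_Functors) (simp_all add: FunctorsD[OF assms(1)] FunctorsD[OF assms(2)])

text \<open>Only closure under identities and composition is demanded of \<open>C\<close>; the unit
  and associativity laws come from \<open>C'\<close>, since both share \<open>Ident\<close> and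
  \<open>Comp\<close>. Fullness is not imposed, as the smaller categories admit only
  isometries.\<close>

definition subcategory :: "('o, 'm) category \<Rightarrow> ('o, 'm) category \<Rightarrow> bool" where
  "subcategory C C' \<longleftrightarrow> is_category C' \<and> Obj C \<subseteq> Obj C' \<and> (\<forall>x\<in>Obj C. \<forall>y\<in>Obj C. Hom C x y \<subseteq> Hom C' x y) \<and>
     Ident C = Ident C' \<and> Comp C = Comp C' \<and>
     (\<forall>x\<in>Obj C. Ident C x \<in> Hom C x x) \<and>
     (\<forall>x\<in>Obj C. \<forall>y\<in>Obj C. \<forall>z\<in>Obj C. \<forall>h\<in>Hom C x y. \<forall>g\<in>Hom C y z. Comp C x y z g h \<in> Hom C x z)"

lemma subcategoryD:
  assumes "subcategory C C'"
  shows "is_category C'" "x \<in> Obj C \<Longrightarrow> x \<in> Obj C'"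
    and "\<lbrakk>x \<in> Obj C; y \<in> Obj C; h \<in> Hom C x y\<rbrakk> \<Longrightarrow> h \<in> Hom C' x y"
    and "Ident C = Ident C'" "Comp C = Comp C'"
    and "x \<in> Obj C \<Longrightarrow> Ident C' x \<in> Hom C x x"
    and "\<lbrakk>x \<in> Obj C; y \<in> Obj C; z \<in> Obj C; h \<in> Hom C x y; g \<in> Hom C y z\<rbrakk>
      \<Longrightarrow> Comp C' x y z g h \<in> Hom C x z"
  using assms unfolding subcategory_def by (simp_all add: subset_iff, metis+)

lemma subcategory_is_category:
  assumes "subcategory C C'" shows "is_category C"
  by (rule is_categoryI)
    (simp_all add: subcategoryD[OF assms] is_categoryD[OF subcategoryD(1)[OF assms]])

text \<open>The functor laws are inherited from \<open>F\<close>, so only the corestriction to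
  \<open>D\<close> on objects and arrows has to be checked.\<close>

lemma restrict_functor_in_Functors:
  assumes C: "subcategory C C'" and D: "subcategory D D'" and F: "F \<in> Functors C' D'"
    and "\<And>x. x \<in> Obj C \<Longrightarrow> FObj F x \<in> Obj D"
    and "\<And>x y h. \<lbrakk>x \<in> Obj C; y \<in> Obj C; h \<in> Hom C x y\<rbrakk> \<Longrightarrow> FArr F x y h \<in> Hom D (FObj F x) (FObj F y)"
  shows "restrict_functor F C D \<in> Functors C D"
  unfolding restrict_functor_def
  using assms(4,5) by (intro mk_functor_in_Functors subcategory_is_category[OF C] subcategory_is_category[OF D])
    (simp_all add: FunctorsD[OF F] subcategoryD[OF C] subcategoryD[OF D])

text \<open>By \<open>F'\<close>, the functor \<open>F\<close> sends \<open>C\<close> into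
  \<open>D\<close>, where \<open>G\<close> and its restriction agree. This deduces the diagram for
  the subcategories from the large one.\<close>

lemma restrict_functor_comp:
  assumes C: "subcategory C C'" and F: "F \<in> Functors C' D'"
    and F': "restrict_functor F C D \<in> Functors C D"
  shows "restrict_functor G D E \<circ>\<^sub>F restrict_functor F C D = restrict_functor (G \<circ>\<^sub>F F) C E"
proof -
  have "FObj F x \<in> Obj D" if "x \<in> Obj C" for x
    using FunctorsD(5)[OF F' that] that by (simp add: restrict_functor_def)
  moreover have "FArr F x y h \<in> Hom D (FObj F x) (FObj F y)"
    if "x \<in> Obj C" "y \<in> Obj C" "h \<in> Hom C x y" for x y h
    using FunctorsD(6)[OF F' that] that by (simp add: restrict_functor_def)
  ultimately show ?thesis
    unfolding restrict_functor_def functor_comp_def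
    by (auto intro!: mk_functor_cong simp: FunctorsD(3)[OF F] subcategoryD[OF C])
qed


section \<open>The categories\<close>

text \<open>Equations between composites become pointwise on the carrier, which lets the simplifier
  use intertwining relations as rewrite rules.\<close>

lemma OCP_simps:
  "(K, \<phi>) \<in> Obj OCP \<longleftrightarrow> hilbert_space K \<and> linear_into_ops K \<phi> \<and> completely_positive K \<phi>"
  "T \<in> Hom OCP (K, \<phi>) (L, \<psi>) \<longleftrightarrow>
    T \<in> bounded_ops K L \<and> (\<forall>a. \<forall>x\<in>carrier K. T (\<phi> a x) = \<psi> a (T x))"
  "Ident OCP (K, \<phi>) = id_op K"
  "Comp OCP (K, \<phi>) y z S T = compose (carrier K) S T"
  by (simp_all add: OCP_def compose_eq_iff)

lemma OpSt_simps:
  "(K, \<phi>) \<in> Obj OpSt \<longleftrightarrow> (K, \<phi>) \<in> Obj OCP \<and> \<phi> 1 = id_op K"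
  "T \<in> Hom OpSt (K, \<phi>) (L, \<psi>) \<longleftrightarrow> T \<in> Hom OCP (K, \<phi>) (L, \<psi>) \<and> T \<in> isometries K L"
  "Ident OpSt = Ident OCP"
  "Comp OpSt = Comp OCP"
  by (simp_all add: OpSt_def)

lemma AnRep_simps:
  "(K, H, \<pi>, V) \<in> Obj AnRep \<longleftrightarrow>
    hilbert_space K \<and> hilbert_space H \<and> representation H \<pi> \<and> V \<in> bounded_ops K H"
  "(T, M) \<in> Hom AnRep (K, H, \<pi>, V) (L, I, \<rho>, W) \<longleftrightarrow>
    T \<in> bounded_ops K L \<and> M \<in> bounded_ops H I \<and>
    (\<forall>a. \<forall>x\<in>carrier H. M (\<pi> a x) = \<rho> a (M x)) \<and> (\<forall>x\<in>carrier K. M (V x) = W (T x)) \<and>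
    (\<forall>x\<in>carrier H. T (adj K H V x) = adj L I W (M x))"
  "Ident AnRep (K, H, \<pi>, V) = (id_op K, id_op H)"
  "Comp AnRep (K, H, \<pi>, V) y z (S, N) (T, M) = (compose (carrier K) S T, compose (carrier H) N M)"
  by (simp_all add: AnRep_def compose_eq_iff)

lemma PAnRep_simps:
  "(K, H, \<pi>, V) \<in> Obj PAnRep \<longleftrightarrow> (K, H, \<pi>, V) \<in> Obj AnRep \<and> V \<in> isometries K H"
  "(T, M) \<in> Hom PAnRep (K, H, \<pi>, V) (L, I, \<rho>, W) \<longleftrightarrow>
    (T, M) \<in> Hom AnRep (K, H, \<pi>, V) (L, I, \<rho>, W) \<and> T \<in> isometries K L \<and> M \<in> isometries H I"
  "Ident PAnRep = Ident AnRep"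
  "Comp PAnRep = Comp AnRep"
  by (simp_all add: PAnRep_def)

lemma is_category_OCP: "is_category (OCP :: ('a::cstar_algebra, 'k) ocp_category)"
proof (rule is_categoryI, goal_cases)
  case (1 x)
  then show ?case
    by (cases x) (auto simp: OCP_simps id_op_bounded_ops bounded_opsD(2)[OF linear_into_opsD(1)])
next
  case (2 x y z h g)
  then show ?case
    by (cases x; cases y; cases z)
      (auto simp: OCP_simps compose_eq compose_bounded_ops bounded_opsD(2)
        bounded_opsD(2)[OF linear_into_opsD(1)])
next
  case (3 x y h)
  then show ?case by (cases x; cases y) (auto simp: OCP_simps compose_id_op)
next
  case (4 x y h)
  then show ?case by (cases x; cases y) (auto simp: OCP_simps id_op_compose)
next
  case (5 w x y z h g k)
  then show ?case
    by (cases w; cases x; cases y; cases z) (auto simp: OCP_simps compose_bounded_ops_assoc)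
qed

lemma subcategory_OpSt:
  "subcategory (OpSt :: ('a::cstar_algebra, 'k) ocp_category) OCP"
  unfolding subcategory_def
proof (intro conjI ballI subsetI, goal_cases)
  case 1
  show ?case by (rule is_category_OCP)
next
  case (6 x)
  then show ?case
    using is_categoryD(1)[OF is_category_OCP, of x]
    by (cases x) (auto simp: OpSt_simps OCP_simps(1,3) id_op_isometries)
next
  case (7 x y z h g)
  then show ?case
    using is_categoryD(2)[OF is_category_OCP, of x y z h g]
    by (cases x; cases y; cases z) (auto simp: OpSt_simps OCP_simps(1,4) compose_isometries)
qed (auto simp: OpSt_simps)

lemma is_category_AnRep: "is_category (AnRep :: ('a::cstar_algebra, 'k, 'h) anrep_category)"
proof (rule is_categoryI, goal_cases)
  case (1 x)
  obtain K H \<pi> V where x: "x = (K, H, \<pi>, V)" by (cases x)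
  with 1 have o: "hilbert_space K" "hilbert_space H" "representation H \<pi>" "V \<in> bounded_ops K H"
    by (auto simp: AnRep_simps)
  show ?case
    using o bounded_opsD(2)[OF o(4)] adj_closed[OF o(1,2,4)]
      bounded_opsD(2)[OF linear_into_opsD(1)[OF representationD(1)[OF o(3)]]]
    by (simp add: x AnRep_simps id_op_bounded_ops)
next
  case (2 x y z h g)
  obtain K H \<pi> V where x: "x = (K, H, \<pi>, V)" by (cases x)
  obtain L I \<rho> W where y: "y = (L, I, \<rho>, W)" by (cases y)
  obtain P J \<sigma> U where z: "z = (P, J, \<sigma>, U)" by (cases z)
  obtain T M where h: "h = (T, M)" by (cases h)
  obtain S N where g: "g = (S, N)" by (cases g)
  have o: "hilbert_space K" "hilbert_space H" "representation H \<pi>" "V \<in> bounded_ops K H"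
    "hilbert_space L" "hilbert_space I" "T \<in> bounded_ops K L" "M \<in> bounded_ops H I"
    "S \<in> bounded_ops L P" "N \<in> bounded_ops I J"
    using 2 by (auto simp: AnRep_simps x y z h g)
  \<comment> \<open>The squares are pasted: \<open>S T V^* = S W^* M = U^* N M\<close>. Evaluating
    the left composite requires \<open>V^* x\<close> to lie in \<open>carrier K\<close>, which
    \<open>adj_closed\<close> supplies.\<close>
  show ?case
    using 2 o bounded_opsD(2)[OF o(4)] bounded_opsD(2)[OF o(7)] bounded_opsD(2)[OF o(8)]
      adj_closed[OF o(1,2,4)]
      bounded_opsD(2)[OF linear_into_opsD(1)[OF representationD(1)[OF o(3)]]]
    by (simp add: x y z h g AnRep_simps compose_eq compose_bounded_ops[OF o(1,5,7,9)] compose_bounded_ops[OF o(2,6,8,10)])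
next
  case (3 x y h)
  then show ?case by (cases x; cases y; cases h) (auto simp: AnRep_simps compose_id_op)
next
  case (4 x y h)
  then show ?case by (cases x; cases y; cases h) (auto simp: AnRep_simps id_op_compose)
next
  case (5 w x y z h g k)
  then show ?case
    by (cases w; cases x; cases y; cases z; cases h; cases g; cases k)
      (auto simp: AnRep_simps compose_bounded_ops_assoc)
qed

lemma subcategory_PAnRep:
  "subcategory (PAnRep :: ('a::cstar_algebra, 'k, 'h) anrep_category) AnRep"
  unfolding subcategory_def
proof (intro conjI ballI subsetI, goal_cases)
  case 1
  show ?case by (rule is_category_AnRep)
next
  case (3 x y h)
  then show ?case by (cases x; cases y; cases h) (auto simp: PAnRep_simps)
next
  case (6 x)
  then show ?case
    using is_categoryD(1)[OF is_category_AnRep, of x]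
    by (cases x) (auto simp: PAnRep_simps AnRep_simps(1,3) id_op_isometries)
next
  case (7 x y z h g)
  then show ?case
    using is_categoryD(2)[OF is_category_AnRep, of x y z h g]
    by (cases x; cases y; cases z; cases h; cases g)
      (auto simp: PAnRep_simps AnRep_simps(1,4) compose_isometries)
qed (auto simp: PAnRep_simps)


section \<open>The diagram\<close>

text \<open>Writing \<open>rest\<close> on arrows as \<open>fst\<close> avoids splitting objects
  into tuples; both ways round the diagram then send \<open>h\<close> to
  \<open>fst h\<close>.\<close>

lemma FArr_simps:
  "\<lbrakk>x \<in> Obj OCP; y \<in> Obj OCP; T \<in> Hom OCP x y\<rbrakk> \<Longrightarrow> FArr (OCP_map f) x y T = T"
  "\<lbrakk>x' \<in> Obj AnRep; y' \<in> Obj AnRep; h \<in> Hom AnRep x' y'\<rbrakk> \<Longrightarrow> FArr (AnRep_map f) x' y' h = h"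
  "\<lbrakk>x' \<in> Obj AnRep; y' \<in> Obj AnRep; h \<in> Hom AnRep x' y'\<rbrakk> \<Longrightarrow> FArr rest x' y' h = fst h"
  by (simp_all add: OCP_map_def AnRep_map_def rest_def split_beta)

lemma OCP_map_in_Functors:
  assumes "star_hom f"
  shows "(OCP_map f :: ('a::cstar_algebra, 'b::cstar_algebra, 'k) ocp_functor) \<in> Functors OCP OCP"
  unfolding OCP_map_def
proof (rule mk_functor_in_Functors[OF is_category_OCP is_category_OCP], goal_cases)
  case (1 x)
  then show ?case
    by (cases x) (simp add: OCP_simps linear_into_ops_star_hom[OF assms] completely_positive_star_hom[OF assms])
next
  case (2 x y h)
  then show ?case by (cases x; cases y) (simp add: OCP_simps)
next
  case (3 x)
  then show ?case by (cases x) (simp add: OCP_simps)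
next
  case (4 x y z h g)
  then show ?case by (cases x; cases y; cases z) (simp add: OCP_simps)
qed

text \<open>Unitality survives because \<open>f 1 = 1\<close>; the isometry condition on arrows does
  not involve \<open>f\<close>.\<close>

lemma OpSt_map_in_Functors:
  assumes "star_hom f"
  shows "(OpSt_map f :: ('a::cstar_algebra, 'b::cstar_algebra, 'k) ocp_functor) \<in> Functors OpSt OpSt"
  unfolding OpSt_map_def
proof (rule restrict_functor_in_Functors[OF subcategory_OpSt subcategory_OpSt OCP_map_in_Functors[OF assms]], goal_cases)
  case (1 x)
  then show ?case
    using FunctorsD(5)[OF OCP_map_in_Functors[OF assms], of x]
    by (cases x) (auto simp: OpSt_simps OCP_map_def star_homD[OF assms])
next
  case (2 x y h)
  then show ?case
    using FunctorsD(6)[OF OCP_map_in_Functors[OF assms], of x y h]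
    by (cases x; cases y) (auto simp: OpSt_simps OCP_map_def)
qed

text \<open>On arrows only the intertwining condition mentions the representation, and for the
  pulled-back one it is the instance at \<open>f a\<close>.\<close>

lemma AnRep_map_in_Functors:
  assumes "star_hom f"
  shows "(AnRep_map f :: ('a::cstar_algebra, 'b::cstar_algebra, 'k, 'h) anrep_functor)
    \<in> Functors AnRep AnRep"
  unfolding AnRep_map_def
proof (rule mk_functor_in_Functors[OF is_category_AnRep is_category_AnRep], goal_cases)
  case (1 x)
  then show ?case by (cases x) (simp add: AnRep_simps representation_star_hom[OF assms])
next
  case (2 x y h)
  then show ?case by (cases x; cases y; cases h) (simp add: AnRep_simps)
next
  case (3 x)
  then show ?case by (cases x) (simp add: AnRep_simps)
next
  case (4 x y z h g)
  then show ?case by (cases x; cases y; cases z; cases h; cases g) (simp add: AnRep_simps)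
qed

lemma PAnRep_map_in_Functors:
  assumes "star_hom f"
  shows "(PAnRep_map f :: ('a::cstar_algebra, 'b::cstar_algebra, 'k, 'h) anrep_functor)
    \<in> Functors PAnRep PAnRep"
  unfolding PAnRep_map_def
proof (rule restrict_functor_in_Functors[OF subcategory_PAnRep subcategory_PAnRep AnRep_map_in_Functors[OF assms]], goal_cases)
  case (1 x)
  then show ?case
    using FunctorsD(5)[OF AnRep_map_in_Functors[OF assms], of x]
    by (cases x) (auto simp: PAnRep_simps AnRep_map_def)
next
  case (2 x y h)
  then show ?case
    using FunctorsD(6)[OF AnRep_map_in_Functors[OF assms], of x y h]
    by (cases x; cases y; cases h) (auto simp: PAnRep_simps AnRep_map_def)
qed

lemma rest_in_Functors:
  "(rest :: ('a::cstar_algebra, 'k, 'h) rest_functor) \<in> Functors AnRep OCP"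
  unfolding rest_def
proof (rule mk_functor_in_Functors[OF is_category_AnRep is_category_OCP], goal_cases)
  case (1 x)
  then show ?case
    by (cases x) (auto simp: AnRep_simps OCP_simps intro: linear_into_ops_compression
      completely_positive_compression dest: representationD(1))
next
  case (2 x y h)
  obtain K H \<pi> V where x: "x = (K, H, \<pi>, V)" by (cases x)
  obtain L I \<rho> W where y: "y = (L, I, \<rho>, W)" by (cases y)
  obtain T M where h: "h = (T, M)" by (cases h)
  have o: "representation H \<pi>" "V \<in> bounded_ops K H" "T \<in> bounded_ops K L"
    using 2 by (auto simp: AnRep_simps x y h)
  \<comment> \<open>The carrier facts allow the morphism conditions to be applied in turn: the
    adjoint square at \<open>\<pi> a (V x)\<close>, intertwining at \<open>V x\<close>, and
    \<open>M (V x) = W (T x)\<close>.\<close>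
  show ?case
    using 2 bounded_opsD(2)[OF o(2)] bounded_opsD(2)[OF o(3)]
      bounded_opsD(2)[OF linear_into_opsD(1)[OF representationD(1)[OF o(1)]]]
    by (simp add: x y h AnRep_simps OCP_simps compose_eq)
qed (auto simp: AnRep_simps OCP_simps)

lemma prest_in_Functors:
  "(prest :: ('a::cstar_algebra, 'k, 'h) rest_functor) \<in> Functors PAnRep OpSt"
  unfolding prest_def
proof (rule restrict_functor_in_Functors[OF subcategory_PAnRep subcategory_OpSt rest_in_Functors], goal_cases)
  case (1 x)
  obtain K H \<pi> V where x: "x = (K, H, \<pi>, V)" by (cases x)
  have o: "hilbert_space K" "hilbert_space H" "V \<in> isometries K H" "representation H \<pi>" "x \<in> Obj AnRep"
    using 1 by (auto simp: x PAnRep_simps AnRep_simps)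
  \<comment> \<open>Since \<open>\<pi> 1\<close> is the identity, this is the relation
    \<open>V^* V = 1\<close> for the isometry \<open>V\<close>.\<close>
  have "compose (carrier K) (adj K H V) (compose (carrier K) (\<pi> 1) V) = id_op K"
    using adj_isometry[OF o(1-3)] representationD(3)[OF o(4)] bounded_opsD(2)[OF isometriesD(1)[OF o(3)]]
    by (auto simp: compose_def id_op_def intro!: restrict_ext)
  then show ?case
    using FunctorsD(5)[OF rest_in_Functors o(5)] o(5) by (simp add: OpSt_simps rest_def x)
next
  case (2 x y h)
  then have "x \<in> Obj AnRep" "y \<in> Obj AnRep" "h \<in> Hom AnRep x y"
    by (auto intro: subcategoryD[OF subcategory_PAnRep])
  with 2 show ?case
    using FunctorsD(6)[OF rest_in_Functors, of x y h]
    by (cases x; cases y; cases h) (auto simp: OpSt_simps PAnRep_simps rest_def)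
qed

text \<open>On objects both sides reduce to the same compression, evaluated at \<open>f a\<close>.
  The functoriality facts show that each inner functor lands where the outer one is not
  \<open>undefined\<close>.\<close>

lemma rest_AnRep_map:
  assumes "star_hom f"
  shows "(rest :: ('b::cstar_algebra, 'k, 'h) rest_functor) \<circ>\<^sub>F AnRep_map f
    = OCP_map f \<circ>\<^sub>F (rest :: ('a::cstar_algebra, 'k, 'h) rest_functor)"
  unfolding functor_comp_def FunctorsD(3)[OF AnRep_map_in_Functors[OF assms]]
    FunctorsD(3)[OF rest_in_Functors] FunctorsD(4)[OF OCP_map_in_Functors[OF assms]]
    FunctorsD(4)[OF rest_in_Functors]
proof (rule mk_functor_cong, goal_cases)
  case (1 x)
  then show ?case
    using FunctorsD(5)[OF AnRep_map_in_Functors[OF assms] 1] FunctorsD(5)[OF rest_in_Functors 1]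
    by (cases x) (auto simp: rest_def AnRep_map_def OCP_map_def comp_def)
next
  case (2 x y h)
  then show ?case
    using FunctorsD(5)[OF AnRep_map_in_Functors[OF assms] 2(1)]
      FunctorsD(5)[OF AnRep_map_in_Functors[OF assms] 2(2)]
      FunctorsD(6)[OF AnRep_map_in_Functors[OF assms] 2]
      FunctorsD(5)[OF rest_in_Functors 2(1)] FunctorsD(5)[OF rest_in_Functors 2(2)]
      FunctorsD(6)[OF rest_in_Functors 2]
    by (simp add: FArr_simps)
qed

theorem lemma4p6:
  fixes f :: "'b::cstar_algebra \<Rightarrow> 'a::cstar_algebra"
  assumes "star_hom f"
  shows "((rest :: ('a, 'k, 'h) rest_functor) \<in> Functors AnRep OCP \<and>
          (rest :: ('b, 'k, 'h) rest_functor) \<in> Functors AnRep OCP \<and>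
          (AnRep_map f :: ('a, 'b, 'k, 'h) anrep_functor) \<in> Functors AnRep AnRep \<and>
          (OCP_map f :: ('a, 'b, 'k) ocp_functor) \<in> Functors OCP OCP \<and>
          (rest :: ('b, 'k, 'h) rest_functor) \<circ>\<^sub>F AnRep_map f \<in> Functors AnRep OCP \<and>
          (rest :: ('b, 'k, 'h) rest_functor) \<circ>\<^sub>F AnRep_map f
            = OCP_map f \<circ>\<^sub>F (rest :: ('a, 'k, 'h) rest_functor)) \<and>
         ((prest :: ('a, 'k, 'h) rest_functor) \<in> Functors PAnRep OpSt \<and>
          (prest :: ('b, 'k, 'h) rest_functor) \<in> Functors PAnRep OpSt \<and>
          (PAnRep_map f :: ('a, 'b, 'k, 'h) anrep_functor) \<in> Functors PAnRep PAnRep \<and>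
          (OpSt_map f :: ('a, 'b, 'k) ocp_functor) \<in> Functors OpSt OpSt \<and>
          (prest :: ('b, 'k, 'h) rest_functor) \<circ>\<^sub>F PAnRep_map f \<in> Functors PAnRep OpSt \<and>
          (prest :: ('b, 'k, 'h) rest_functor) \<circ>\<^sub>F PAnRep_map f
            = OpSt_map f \<circ>\<^sub>F (prest :: ('a, 'k, 'h) rest_functor))"
proof (intro conjI)
  note eq = rest_AnRep_map[OF assms, where ?'k = 'k and ?'h = 'h]
  show "(rest :: ('b, 'k, 'h) rest_functor) \<circ>\<^sub>F AnRep_map f
      = OCP_map f \<circ>\<^sub>F (rest :: ('a, 'k, 'h) rest_functor)"
    by (rule eq)
  show "(prest :: ('b, 'k, 'h) rest_functor) \<circ>\<^sub>F PAnRep_map f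
      = OpSt_map f \<circ>\<^sub>F (prest :: ('a, 'k, 'h) rest_functor)"
    \<comment> \<open>Both composites are restrictions, to \<open>PAnRep\<close> with target
      \<open>OpSt\<close>, of the two sides of \<open>eq\<close>.\<close>
    using eq
      restrict_functor_comp[OF subcategory_PAnRep AnRep_map_in_Functors[OF assms]
        PAnRep_map_in_Functors[OF assms, unfolded PAnRep_map_def]]
      restrict_functor_comp[OF subcategory_PAnRep rest_in_Functors
        prest_in_Functors[unfolded prest_def]]
    unfolding prest_def PAnRep_map_def OpSt_map_def by metis
qed (simp_all add: assms rest_in_Functors prest_in_Functors AnRep_map_in_Functors
    PAnRep_map_in_Functors OCP_map_in_Functors OpSt_map_in_Functors
    functor_comp_in_Functors[OF AnRep_map_in_Functors[OF assms] rest_in_Functors]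
    functor_comp_in_Functors[OF PAnRep_map_in_Functors[OF assms] prest_in_Functors])

end
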